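(* Let $g:\mathbb{F}_2^n\to\mathbb{F}_2$ be an arbitrary Boolean function and $\Pi:\mathbb{F}_2^n\to\mathbb{F}_2^n$ a map, and define $f:\mathbb{F}_2^n\times\mathbb{F}_2^n\to\mathbb{F}_2$ by $f(x,y)=\langle x,\Pi(y)\rangle+g(y)$. Let $\Lambda$ be any subset of the index set of the variables $y_0,\dots,y_{n-1}$. Then $f$ is shifted-bent with respect to $\Lambda$ if and only if $\Pi$ is a permutation of $\mathbb{F}_2^n$.
   Context: $\langle x,y\rangle=\sum_i x_iy_i$. A Boolean function $F:\mathbb{F}_2^m\to\mathbb{F}_2$ is balanced if it takes the values $0$ and $1$ equally often. $F$ is shifted-bent with respect to $\Lambda\subseteq\{0,\dots,m-1\}$ if for every nonzero $a\in\mathbb{F}_2^m$ the function $z\mapsto F(z+a)+F(z)+\sum_{i\in\Lambda}z_ia_i$ is balanced. Here $m=2n$ and the coordinates of $z=(x,y)$ are $x_0,\dots,x_{n-1},y_0,\dots,y_{n-1}$; $\Lambda$ consists only of positions of $y$-coordinates. *)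

theory Defs
  imports "HOL-Analysis.Finite_Cartesian_Product" "HOL-Library.Z2"
begin

instance bit :: finite
proof
  have "(UNIV :: bit set) = {0, 1}"
    by auto
  then show "finite (UNIV :: bit set)"
    by (metis finite.emptyI finite.insertI)
qed

definition balanced :: "(bit ^ 'm \<Rightarrow> bit) \<Rightarrow> bool" where
  "balanced F \<longleftrightarrow> card {z. F z = 0} = card {z. F z = 1}"

definition shifted_bent :: "'m set \<Rightarrow> (bit ^ 'm \<Rightarrow> bit) \<Rightarrow> bool" where
  "shifted_bent \<Lambda> F \<longleftrightarrow>
    (\<forall>a. a \<noteq> 0 \<longrightarrow> balanced (\<lambda>z. F (z + a) + F z + (\<Sum>i\<in>\<Lambda>. z $ i * a $ i)))"

text \<open>
  The space of dimension \<open>2 n\<close> has the index type \<^typ>\<open>'n + 'n\<close>: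
  position \<open>Inl i\<close> carries the variable \<open>x\<^sub>i\<close> and position \<open>Inr i\<close> the variable \<open>y\<^sub>i\<close>.
\<close>

definition x_part :: "'a ^ ('n + 'n) \<Rightarrow> 'a ^ 'n" where
  "x_part z = (\<chi> i. z $ Inl i)"

definition y_part :: "'a ^ ('n + 'n) \<Rightarrow> 'a ^ 'n" where
  "y_part z = (\<chi> i. z $ Inr i)"

end

theory Submission
  imports Defs
begin

text \<open>
  Balancedness is vanishing of the sum of the signs of the values. In the direction \<open>(a, b)\<close> the
  derivative is \<open>\<langle>x, \<pi> (y + b) + \<pi> y\<rangle>\<close> plus a function of \<open>y\<close>. If \<open>\<pi>\<close> is injective and \<open>b \<noteq> 0\<close>, the
  sum over \<open>x\<close> vanishes for each \<open>y\<close>. If \<open>b = 0\<close>, the derivative is \<open>\<langle>a, \<pi> y\<rangle>\<close>, as \<open>\<Lambda>\<close> does not see the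
  \<open>x\<close>-coordinates. Balancedness of all \<open>\<langle>a, \<pi> y\<rangle>\<close> with \<open>a \<noteq> 0\<close> says that the nontrivial Fourier
  coefficients of the distribution of \<open>\<pi> y\<close> vanish, hence that this distribution is uniform.
\<close>

text \<open>This is the nontrivial additive character of the two-element field, with values in the
  integers so that sums of signs count without reduction modulo 2.\<close>

definition sign_bit :: "bit \<Rightarrow> int" where
  "sign_bit b = (if b = 0 then 1 else - 1)"

lemma sign_bit_0 [simp]: "sign_bit 0 = 1"
  by (simp add: sign_bit_def)

lemma sign_bit_1 [simp]: "sign_bit 1 = - 1"
  by (simp add: sign_bit_def)

lemma sign_bit_add: "sign_bit (b + c) = sign_bit b * sign_bit c"
  by (cases b; cases c) simp_all

lemma balanced_iff_sum_sign_bit: "balanced F \<longleftrightarrow> (\<Sum>z\<in>UNIV. sign_bit (F z)) = 0"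
proof -
  have "(\<Sum>z\<in>UNIV. sign_bit (F z)) = (\<Sum>z\<in>UNIV. of_bool (F z = 0) - of_bool (F z = 1))"
    by (rule sum.cong) (auto simp: sign_bit_def)
  also have "\<dots> = int (card {z. F z = 0}) - int (card {z. F z = 1})"
    by (simp add: sum_subtractf sum_of_bool_eq)
  finally show ?thesis
    by (simp add: balanced_def)
qed

lemma bit_add_self [simp]: "b + b = (0::bit)"
  by (cases b) simp_all

lemma bit_vec_add_self [simp]: "x + x = (0 :: bit ^ 'm)"
  by (simp add: vec_eq_iff)

lemma bit_vec_add_eq_0_iff: "x + y = 0 \<longleftrightarrow> x = (y :: bit ^ 'm)"
  by (metis add.assoc add.right_neutral bit_vec_add_self add.left_neutral)

lemma scalar_product_commute:
  "scalar_product x y = scalar_product y (x :: 'a::comm_semiring_1 ^ 'm)"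
  by (simp add: scalar_product_def mult.commute)

lemma scalar_product_add_left:
  "scalar_product (x + y) z = scalar_product x z + scalar_product y (z :: 'a::comm_semiring_1 ^ 'm)"
  by (simp add: scalar_product_def distrib_right sum.distrib)

lemma scalar_product_add_right:
  "scalar_product x (y + z) = scalar_product x y + scalar_product x (z :: 'a::comm_semiring_1 ^ 'm)"
  by (simp add: scalar_product_def distrib_left sum.distrib)

lemma scalar_product_0_left [simp]: "scalar_product 0 (x :: 'a::comm_semiring_1 ^ 'm) = 0"
  by (simp add: scalar_product_def)

lemma scalar_product_0_right [simp]: "scalar_product (x :: 'a::comm_semiring_1 ^ 'm) 0 = 0"
  by (simp add: scalar_product_def)

lemma scalar_product_axis_left:
  "scalar_product (axis i 1) (x :: 'a::comm_semiring_1 ^ 'm) = x $ i"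
proof -
  have "scalar_product (axis i 1) x = (\<Sum>j\<in>UNIV. if j = i then x $ j else 0)"
    unfolding scalar_product_def axis_def by (rule sum.cong) auto
  then show ?thesis
    by simp
qed

text \<open>Flipping a coordinate of \<open>x\<close> at which \<open>u\<close> is 1 permutes the
  summands and negates each of them, so the sum equals its own negative.\<close>

lemma sum_sign_bit_scalar_product:
  fixes u :: "bit ^ 'm"
  assumes "u \<noteq> 0"
  shows "(\<Sum>x\<in>UNIV. sign_bit (scalar_product x u)) = 0"
proof -
  obtain i where "u $ i = 1"
    using assms by (auto simp: vec_eq_iff)
  then have flip: "sign_bit (scalar_product (x + axis i 1) u) = - sign_bit (scalar_product x u)" for x
    by (simp add: scalar_product_add_left scalar_product_axis_left sign_bit_add)
  have "(\<Sum>x\<in>UNIV. sign_bit (scalar_product x u)) =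
      (\<Sum>x\<in>UNIV. sign_bit (scalar_product (x + axis i 1) u))"
    by (rule sum.reindex_bij_witness[of _ "\<lambda>x. x + axis i 1" "\<lambda>x. x + axis i 1"])
      (simp_all add: add.assoc)
  then show ?thesis
    by (simp add: flip sum_negf)
qed

text \<open>Double counting: if \<open>u\<close> is missed, \<open>\<pi> y + u\<close> is never 0,
  so summing the signs of \<open>scalar_product a (\<pi> y + u)\<close> over \<open>a\<close> first
  gives 0. Summing over \<open>y\<close> first leaves only \<open>a = 0\<close>, which contributes
  the size of the domain.\<close>

lemma surj_of_balanced_components:
  fixes \<pi> :: "'b::finite \<Rightarrow> bit ^ 'n"
  assumes bal: "\<And>a. a \<noteq> 0 \<Longrightarrow> (\<Sum>y\<in>UNIV. sign_bit (scalar_product a (\<pi> y))) = 0"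
  shows "surj \<pi>"
proof (rule ccontr)
  assume "\<not> surj \<pi>"
  then obtain u where "\<And>y. \<pi> y \<noteq> u"
    by (metis surjI)
  then have "0 = (\<Sum>y\<in>UNIV. \<Sum>a\<in>UNIV. sign_bit (scalar_product a (\<pi> y + u)))"
    by (simp add: sum_sign_bit_scalar_product bit_vec_add_eq_0_iff)
  also have "\<dots> = (\<Sum>a\<in>UNIV. \<Sum>y\<in>UNIV. sign_bit (scalar_product a (\<pi> y + u)))"
    by (rule sum.swap)
  also have "\<dots> = (\<Sum>a\<in>UNIV.
      (\<Sum>y\<in>UNIV. sign_bit (scalar_product a (\<pi> y))) * sign_bit (scalar_product a u))"
    by (simp only: scalar_product_add_right sign_bit_add sum_distrib_right)
  also have "\<dots> = (\<Sum>a\<in>(UNIV :: (bit ^ 'n) set). if a = 0 then int CARD('b) else 0)"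
    by (rule sum.cong) (auto simp: bal)
  also have "\<dots> = int CARD('b)"
    by simp
  finally show False
    by simp
qed

definition vec_pair :: "'a ^ 'n \<Rightarrow> 'a ^ 'n \<Rightarrow> 'a ^ ('n + 'n)" where
  "vec_pair x y = (\<chi> i. case i of Inl j \<Rightarrow> x $ j | Inr j \<Rightarrow> y $ j)"

lemma vec_pair_nth [simp]:
  "vec_pair x y $ Inl j = x $ j" "vec_pair x y $ Inr j = y $ j"
  by (simp_all add: vec_pair_def)

lemma x_part_vec_pair [simp]: "x_part (vec_pair x y) = x"
  by (simp add: x_part_def)

lemma y_part_vec_pair [simp]: "y_part (vec_pair x y) = y"
  by (simp add: y_part_def)

lemma vec_pair_parts [simp]: "vec_pair (x_part z) (y_part z) = z"
  by (auto simp: vec_pair_def x_part_def y_part_def vec_eq_iff split: sum.split)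

lemma vec_pair_add: "vec_pair x y + vec_pair a b = vec_pair (x + a) (y + b)"
  by (auto simp: vec_pair_def vec_eq_iff split: sum.split)

lemma vec_pair_eq_0_iff: "vec_pair x y = 0 \<longleftrightarrow> x = 0 \<and> y = 0"
  by (auto simp: vec_pair_def vec_eq_iff split: sum.split)

lemma all_vec_pair: "(\<forall>z. P z) \<longleftrightarrow> (\<forall>x y. P (vec_pair x y))"
proof
  assume P: "\<forall>x y. P (vec_pair x y)"
  show "\<forall>z. P z"
  proof
    show "P z" for z
      using P[rule_format, of "x_part z" "y_part z"] by simp
  qed
qed simp

text \<open>The sum over \<open>x\<close> is the inner one because, for fixed \<open>y\<close>, the
  derivative of \<open>f\<close> is affine in \<open>x\<close>.\<close>

lemma sum_vec_pair:
  fixes h :: "'a::finite ^ ('n::finite + 'n) \<Rightarrow> 'c::comm_monoid_add"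
  shows "(\<Sum>z\<in>UNIV. h z) = (\<Sum>y\<in>UNIV. \<Sum>x\<in>UNIV. h (vec_pair x y))"
proof -
  have "(\<Sum>z\<in>UNIV. h z) = (\<Sum>(y, x)\<in>UNIV \<times> UNIV. h (vec_pair x y))"
    by (rule sum.reindex_bij_witness[of _ "\<lambda>(y, x). vec_pair x y" "\<lambda>z. (y_part z, x_part z)"]) auto
  then show ?thesis
    by (simp add: sum.cartesian_product)
qed

theorem theorem5p1:
  fixes g :: "bit ^ 'n \<Rightarrow> bit"
    and \<pi> :: "bit ^ 'n \<Rightarrow> bit ^ 'n"
    and f :: "(bit ^ 'n) \<times> (bit ^ 'n) \<Rightarrow> bit"
    and \<Lambda> :: "('n + 'n) set"
  assumes "\<And>x y. f (x, y) = scalar_product x (\<pi> y) + g y"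
    and "\<Lambda> \<subseteq> range Inr"
  shows "shifted_bent \<Lambda> (\<lambda>z. f (x_part z, y_part z)) \<longleftrightarrow> bij \<pi>"
proof -
  \<comment> \<open>The zeros fill the \<open>x\<close>-positions, which \<open>\<Lambda>\<close>
    avoids; any other entries there would give the same sum.\<close>
  define q where "q y b = (\<Sum>i\<in>\<Lambda>. vec_pair 0 y $ i * vec_pair 0 b $ i)" for y b :: "bit ^ 'n"
  have q: "(\<Sum>i\<in>\<Lambda>. vec_pair x y $ i * vec_pair a b $ i) = q y b" for x y a b
    unfolding q_def using assms(2) by (intro sum.cong) auto
  have q0: "q y 0 = 0" for y
    unfolding q_def using assms(2) by (intro sum.neutral) auto
  \<comment> \<open>This is the sign sum of the derivative in direction \<open>(a, b)\<close>, with
    the factor free of \<open>x\<close> pulled out of the inner sum.\<close>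
  define S where "S a b = (\<Sum>y\<in>UNIV. (\<Sum>x\<in>UNIV. sign_bit (scalar_product x (\<pi> (y + b) + \<pi> y))) *
    sign_bit (scalar_product a (\<pi> (y + b)) + g (y + b) + g y + q y b))" for a b
  have "balanced (\<lambda>z. f (x_part (z + vec_pair a b), y_part (z + vec_pair a b)) +
      f (x_part z, y_part z) + (\<Sum>i\<in>\<Lambda>. z $ i * vec_pair a b $ i)) \<longleftrightarrow> S a b = 0" for a b
    \<comment> \<open>The default simpset turns sums of bits into equivalences of equations, hence \<open>simp only\<close>.\<close>
    unfolding balanced_iff_sum_sign_bit sum_vec_pair S_def
    by (simp only: vec_pair_add x_part_vec_pair y_part_vec_pair q assms(1) scalar_product_add_left
        scalar_product_add_right sign_bit_add sum_distrib_right)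
      (simp only: mult_ac)
  then have bent: "shifted_bent \<Lambda> (\<lambda>z. f (x_part z, y_part z)) \<longleftrightarrow>
      (\<forall>a b. a \<noteq> 0 \<or> b \<noteq> 0 \<longrightarrow> S a b = 0)"
    unfolding shifted_bent_def all_vec_pair by (simp only: vec_pair_eq_0_iff de_Morgan_conj)
  \<comment> \<open>For \<open>b = 0\<close> both values of \<open>g\<close> cancel and the inner
    sum consists of ones only.\<close>
  have "S a 0 = (\<Sum>y\<in>UNIV. int CARD(bit ^ 'n) * sign_bit (scalar_product a (\<pi> y)))" for a
    unfolding S_def
    by (simp only: add_0_right q0 add.assoc bit_add_self bit_vec_add_self scalar_product_0_right
        sign_bit_0 sum_constant of_nat_mult mult_1_right)
  then have "S a 0 = int CARD(bit ^ 'n) * (\<Sum>y\<in>UNIV. sign_bit (scalar_product a (\<pi> y)))" for a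
    by (simp only: sum_distrib_left)
  moreover have "int CARD(bit ^ 'n) \<noteq> 0"
    using zero_less_card_finite[where 'a = "bit ^ 'n"] by linarith
  ultimately have S0: "S a 0 = 0 \<longleftrightarrow> (\<Sum>y\<in>UNIV. sign_bit (scalar_product a (\<pi> y))) = 0" for a
    by (simp only: mult_eq_0_iff simp_thms)
  show ?thesis
  proof
    assume "shifted_bent \<Lambda> (\<lambda>z. f (x_part z, y_part z))"
    then have "surj \<pi>"
      using bent by (intro surj_of_balanced_components) (simp flip: S0)
    then show "bij \<pi>"
      by (simp add: bij_def finite_UNIV_surj_inj)
  next
    assume "bij \<pi>"
    have "S a b = 0" if "a \<noteq> 0 \<or> b \<noteq> 0" for a b
    proof (cases "b = 0")
      case True
      \<comment> \<open>Substituting along the bijection removes \<open>\<pi>\<close> and leaves a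
        full character sum with \<open>a\<close> nonzero.\<close>
      have "(\<Sum>y\<in>UNIV. sign_bit (scalar_product a (\<pi> y))) =
          (\<Sum>y\<in>UNIV. sign_bit (scalar_product y a))"
        by (subst scalar_product_commute, rule sum.reindex_bij_betw[OF \<open>bij \<pi>\<close>])
      then show ?thesis
        using True that by (simp add: S0 sum_sign_bit_scalar_product)
    next
      case False
      then have "\<pi> (y + b) + \<pi> y \<noteq> 0" for y
        using \<open>bij \<pi>\<close> by (simp add: bit_vec_add_eq_0_iff bij_def inj_eq)
      then show ?thesis
        by (simp add: S_def sum_sign_bit_scalar_product)
    qed
    then show "shifted_bent \<Lambda> (\<lambda>z. f (x_part z, y_part z))"
      by (simp add: bent)
  qed
qed

end
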